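(* Let $q\ge 2$ be an integer and let $\Pi_q$ be any projective plane (not necessarily Desarguesian) of order $q$, and let $s(2,q)$ be the smallest size of a saturating set in $\Pi_q$. Then for every real number $\xi$ with $1\le \xi\le q^2$, \[ s(2,q)\leq \sqrt{2(q+1)}\,\sqrt{\ln \frac{q^2}{\xi}}+\frac{\xi}{2}+3 . \]
   Context: A point set $\mathcal{S}$ in a projective plane $\Pi_q$ is saturating if every point of $\Pi_q\setminus\mathcal{S}$ is collinear with two points of $\mathcal{S}$. $\ln$ is the natural logarithm. *)

theory Defs
  imports Complex_Main
begin

definition collinear3 :: "'l set \<Rightarrow> ('p \<Rightarrow> 'l \<Rightarrow> bool) \<Rightarrow> 'p \<Rightarrow> 'p \<Rightarrow> 'p \<Rightarrow> bool" where
  "collinear3 L inc a b c \<longleftrightarrow> (\<exists>l\<in>L. inc a l \<and> inc b l \<and> inc c l)"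

locale projective_plane =
  fixes P :: "'p set" and L :: "'l set" and inc :: "'p \<Rightarrow> 'l \<Rightarrow> bool"
  assumes unique_line: "\<lbrakk>a \<in> P; b \<in> P; a \<noteq> b\<rbrakk> \<Longrightarrow> \<exists>!l. l \<in> L \<and> inc a l \<and> inc b l"
    and unique_point: "\<lbrakk>l \<in> L; m \<in> L; l \<noteq> m\<rbrakk> \<Longrightarrow> \<exists>!a. a \<in> P \<and> inc a l \<and> inc a m"
    and quadrangle: "\<exists>a\<in>P. \<exists>b\<in>P. \<exists>c\<in>P. \<exists>d\<in>P. distinct [a, b, c, d] \<and>
      \<not> collinear3 L inc a b c \<and> \<not> collinear3 L inc a b d \<and>
      \<not> collinear3 L inc a c d \<and> \<not> collinear3 L inc b c d"

text \<open>The requirement forces every line to have finitely many points, since \<^const>\<open>card\<close> is 0 on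
  infinite sets.\<close>

locale projective_plane_of_order = projective_plane P L inc
  for P :: "'p set" and L :: "'l set" and inc :: "'p \<Rightarrow> 'l \<Rightarrow> bool" +
  fixes q :: nat
  assumes card_line: "l \<in> L \<Longrightarrow> card {a \<in> P. inc a l} = q + 1"

definition saturating :: "'p set \<Rightarrow> 'l set \<Rightarrow> ('p \<Rightarrow> 'l \<Rightarrow> bool) \<Rightarrow> 'p set \<Rightarrow> bool" where
  "saturating P L inc S \<longleftrightarrow> S \<subseteq> P \<and>
     (\<forall>x \<in> P - S. \<exists>a\<in>S. \<exists>b\<in>S. a \<noteq> b \<and> collinear3 L inc a b x)"

definition smallest_saturating_size :: "'p set \<Rightarrow> 'l set \<Rightarrow> ('p \<Rightarrow> 'l \<Rightarrow> bool) \<Rightarrow> nat" where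
  "smallest_saturating_size P L inc =
     (LEAST n. \<exists>S. saturating P L inc S \<and> finite S \<and> card S = n)"

end

theory Submission
  imports Defs
begin

text \<open>Points are added greedily to a set \<open>S\<close>. If \<open>B\<close> lies on no secant of \<open>S\<close> and \<open>w = card S\<close>, the
  \<open>w\<close> lines joining \<open>B\<close> to \<open>S\<close> are distinct, so \<open>w(q - 1) + 1\<close> points outside \<open>S\<close> cover \<open>B\<close> when added.
  Averaging over the at most \<open>q\<^sup>2 + q + 1 - w\<close> points outside \<open>S\<close>, some point covers at least a fraction
  \<open>(w - 1/2)/(q + 1)\<close> of the uncovered points. Starting from two points, which leave at most \<open>q\<^sup>2\<close> points
  uncovered, \<open>n\<close> points leave at most \<open>q\<^sup>2 exp(-((n - 1)\<^sup>2 - 1)/(2(q + 1)))\<close> uncovered. Once this number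
  is at most \<open>\<xi>\<close>, the remaining points are covered two at a time, by the intersection of a line
  joining the first to \<open>S\<close> and a line joining the second to \<open>S\<close>. For \<open>\<xi> \<ge> q\<^sup>2/2\<close>, a line together with
  one further point is already small enough.\<close>

section \<open>Uncovered points and the effect of adding a point\<close>

definition uncovered :: "'p set \<Rightarrow> 'l set \<Rightarrow> ('p \<Rightarrow> 'l \<Rightarrow> bool) \<Rightarrow> 'p set \<Rightarrow> 'p set" where
  "uncovered P L inc S = {x \<in> P - S. \<not> (\<exists>a\<in>S. \<exists>b\<in>S. a \<noteq> b \<and> collinear3 L inc a b x)}"

text \<open>The effect of enlarging \<open>S\<close> by \<open>a\<close>: \<open>b\<close> becomes a
  member of the set or lies on a secant through \<open>a\<close>. Demanding
  \<open>p \<noteq> a\<close> keeps the secant genuine when \<open>a\<close> is already in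
  \<open>S\<close>.\<close>

definition covers :: "'l set \<Rightarrow> ('p \<Rightarrow> 'l \<Rightarrow> bool) \<Rightarrow> 'p set \<Rightarrow> 'p \<Rightarrow> 'p \<Rightarrow> bool" where
  "covers L inc S a b \<longleftrightarrow> a = b \<or> (\<exists>p\<in>S. p \<noteq> a \<and> collinear3 L inc p a b)"

lemma uncovered_subset: "uncovered P L inc S \<subseteq> P - S"
  by (auto simp: uncovered_def)

lemma saturating_iff_uncovered_empty:
  "saturating P L inc S \<longleftrightarrow> S \<subseteq> P \<and> uncovered P L inc S = {}"
  by (auto simp: saturating_def uncovered_def)

lemma uncovered_insert_subset:
  "uncovered P L inc (insert a S) \<subseteq> {b \<in> uncovered P L inc S. \<not> covers L inc S a b}"
  by (auto simp: uncovered_def covers_def)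

lemma smallest_saturating_size_le:
  assumes "saturating P L inc S" "finite S"
  shows "smallest_saturating_size P L inc \<le> card S"
  unfolding smallest_saturating_size_def using assms by (intro Least_le) blast

section \<open>Incidence and completion by pairs\<close>

context projective_plane
begin

lemma line_through:
  assumes "a \<in> P" "b \<in> P" "a \<noteq> b"
  obtains l where "l \<in> L" "inc a l" "inc b l"
    "\<And>x. collinear3 L inc a b x \<longleftrightarrow> inc x l"
proof -
  obtain l where l: "l \<in> L" "inc a l" "inc b l"
    using unique_line[OF assms] by blast
  have "m = l" if "m \<in> L" "inc a m" "inc b m" for m
    using unique_line[OF assms] that l by blast
  then have "collinear3 L inc a b x \<longleftrightarrow> inc x l" for x
    using l unfolding collinear3_def by blast
  with l show ?thesis
    using that by blast
qed

lemma exists_line_and_point_off: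
  obtains a b c l where "a \<in> P" "b \<in> P" "c \<in> P" "a \<noteq> b" "l \<in> L" "inc a l" "inc b l"
    "\<not> inc c l" "\<And>x. collinear3 L inc a b x \<longleftrightarrow> inc x l"
proof -
  obtain a b c where abc: "a \<in> P" "b \<in> P" "c \<in> P" "a \<noteq> b" "\<not> collinear3 L inc a b c"
    using quadrangle by auto
  obtain l where l: "l \<in> L" "inc a l" "inc b l" "\<And>x. collinear3 L inc a b x \<longleftrightarrow> inc x l"
    using line_through[OF abc(1,2,4)] by blast
  show ?thesis
    using that[OF abc(1-4) l(1-3) _ l(4)] abc(5) l(4) by blast
qed

text \<open>The lines \<open>l\<close> through \<open>p\<close>, \<open>b\<close> and
  \<open>m\<close> through \<open>p'\<close>, \<open>b'\<close> differ: if \<open>p'\<close> were on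
  \<open>l\<close>, then \<open>b\<close> would lie on the secant through \<open>p\<close> and
  \<open>p'\<close>; likewise \<open>p\<close> is not on \<open>m\<close>. Their common point is
  therefore neither \<open>p\<close> nor \<open>p'\<close> and sees both targets.\<close>

lemma exists_point_covering_two:
  assumes S: "S \<subseteq> P" "p \<in> S" "p' \<in> S" "p \<noteq> p'"
    and b: "b \<in> uncovered P L inc S" "b' \<in> uncovered P L inc S"
  obtains a where "a \<in> P" "covers L inc S a b" "covers L inc S a b'"
proof -
  have bP: "b \<in> P" "b \<notin> S" "b' \<in> P" "b' \<notin> S"
    using b by (auto simp: uncovered_def)
  obtain l where l: "l \<in> L" "inc p l" "inc b l"
    by (rule line_through[of p b]) (use S bP in auto)
  obtain m where m: "m \<in> L" "inc p' m" "inc b' m"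
    by (rule line_through[of p' b']) (use S bP in auto)
  have "\<not> inc p' l" "\<not> inc p m"
    using b l m S unfolding uncovered_def collinear3_def by blast+
  then have "l \<noteq> m"
    using l by auto
  then obtain a where a: "a \<in> P" "inc a l" "inc a m"
    using unique_point[OF l(1) m(1)] by blast
  have "p \<noteq> a" "p' \<noteq> a"
    using a \<open>\<not> inc p' l\<close> \<open>\<not> inc p m\<close> by auto
  then have "covers L inc S a b" "covers L inc S a b'"
    using a l m S unfolding covers_def collinear3_def by blast+
  with a show ?thesis
    using that by blast
qed

text \<open>Each new point removes two uncovered points, and a single leftover is added itself;
  hence the count is half the number of uncovered points, rounded up. Two points in \<open>S\<close>
  serve as the base points \<open>p\<close> and \<open>p'\<close>.\<close>

lemma extend_to_saturating:
  assumes "finite P" "S \<subseteq> P" "card S \<ge> 2"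
  shows "\<exists>S'. saturating P L inc S' \<and> finite S' \<and>
    card S' \<le> card S + (card (uncovered P L inc S) + 1) div 2"
  using assms(2,3)
proof (induction "card (uncovered P L inc S)" arbitrary: S rule: less_induct)
  case less
  let ?U = "uncovered P L inc"
  have fin: "finite S" "finite (?U T)" for T
    using less.prems(1) uncovered_subset[of P L inc T] assms(1) by (blast intro: finite_subset)+
  consider "?U S = {}" | b where "?U S = {b}" | b b' where "b \<in> ?U S" "b' \<in> ?U S" "b \<noteq> b'"
    by blast
  then show ?case
  proof cases
    case 1
    then show ?thesis
      using less.prems fin by (intro exI[of _ S]) (simp add: saturating_iff_uncovered_empty)
  next
    case 2
    then have "?U (insert b S) = {}"
      using uncovered_insert_subset[of P L inc b S] by (auto simp: covers_def)
    moreover have "b \<in> P"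
      using 2 uncovered_subset[of P L inc S] by auto
    ultimately show ?thesis
      using 2 less.prems fin
      by (intro exI[of _ "insert b S"]) (simp add: saturating_iff_uncovered_empty card_insert_if)
  next
    case 3
    have "\<exists>p p'. p \<in> S \<and> p' \<in> S \<and> p \<noteq> p'"
    proof (rule ccontr)
      assume "\<not> ?thesis"
      then have "card S \<le> 1"
        using fin(1) by (auto simp: card_le_Suc0_iff_eq)
      then show False
        using less.prems by simp
    qed
    then obtain p p' where "p \<in> S" "p' \<in> S" "p \<noteq> p'"
      by blast
    then obtain a where a: "a \<in> P" "covers L inc S a b" "covers L inc S a b'"
      using exists_point_covering_two[OF less.prems(1)] 3 by blast
    have "?U (insert a S) \<subseteq> ?U S - {b, b'}"
      using uncovered_insert_subset[of P L inc a S] a by auto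
    then have "card (?U (insert a S)) \<le> card (?U S - {b, b'})"
      using fin by (intro card_mono) auto
    also have "\<dots> = card (?U S) - 2"
      using 3 fin by (subst card_Diff_subset) auto
    finally have le: "card (?U (insert a S)) \<le> card (?U S) - 2" .
    have ge: "card (?U S) \<ge> 2"
      using 3 fin card_mono[of "?U S" "{b, b'}"] by auto
    have "card (insert a S) \<ge> 2"
      using less.prems fin by (simp add: card_insert_if)
    then obtain S' where S': "saturating P L inc S'" "finite S'"
      "card S' \<le> card (insert a S) + (card (?U (insert a S)) + 1) div 2"
      using less.hyps[of "insert a S"] le ge a(1) less.prems(1) by fastforce
    have "card (insert a S) \<le> card S + 1"
      using fin by (simp add: card_insert_if)
    with S'(3) le ge have "card S' \<le> card S + (card (?U S) + 1) div 2"
      by linarith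
    with S' show ?thesis
      by blast
  qed
qed

end

section \<open>Counting in a plane of order \<open>q\<close> and the greedy phase\<close>

lemma covering_fraction_bound:
  fixes w q :: real
  assumes "q \<ge> 1" "w < q\<^sup>2 + q + 1"
  shows "(w - 1/2) / (q + 1) \<le> (w * (q - 1) + 1) / (q\<^sup>2 + q + 1 - w)"
proof -
  \<comment> \<open>Both denominators are positive, so the claim is this difference being
    nonnegative. It is a quadratic in \<open>w\<close>; completing the square leaves a positive
    remainder.\<close>
  have "(w * (q - 1) + 1) * (q + 1) - (w - 1/2) * (q\<^sup>2 + q + 1 - w)
      = (w - (q + 5/2) / 2)\<^sup>2 + (4 * q\<^sup>2 + 4 * q - 1) / 16"
    by (simp add: power2_eq_square field_simps)
  also have "\<dots> \<ge> 0"
    using assms zero_le_power2[of q] by (intro add_nonneg_nonneg divide_nonneg_nonneg) (simp, linarith, simp)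
  finally show ?thesis
    using assms by (simp add: field_simps)
qed

context projective_plane_of_order
begin

lemma finite_line: "l \<in> L \<Longrightarrow> finite {x \<in> P. inc x l}"
  using card_line[of l] by (intro card_ge_0_finite) simp

lemma card_punctured_line:
  assumes "a \<in> P" "b \<in> P" "a \<noteq> b"
  shows "finite {x \<in> P. x \<noteq> a \<and> collinear3 L inc a b x}"
    and "card {x \<in> P. x \<noteq> a \<and> collinear3 L inc a b x} = q"
proof -
  obtain l where l: "l \<in> L" "inc a l" "\<And>x. collinear3 L inc a b x \<longleftrightarrow> inc x l"
    using line_through[OF assms] by blast
  have eq: "{x \<in> P. x \<noteq> a \<and> collinear3 L inc a b x} = {x \<in> P. inc x l} - {a}"
    using l by auto
  show "finite {x \<in> P. x \<noteq> a \<and> collinear3 L inc a b x}"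
    "card {x \<in> P. x \<noteq> a \<and> collinear3 L inc a b x} = q"
    unfolding eq using finite_line[OF l(1)] card_line[OF l(1)] l assms by auto
qed

text \<open>Projection from \<open>c\<close> onto \<open>l\<close>: every point other than
  \<open>c\<close> lies on one of the \<open>q + 1\<close> lines joining \<open>c\<close> to a point
  of \<open>l\<close>, and each of these has \<open>q\<close> points besides
  \<open>c\<close>.\<close>

lemma finite_points: "finite P" and card_points_le: "card P \<le> q\<^sup>2 + q + 1"
proof -
  obtain a b c l where l: "a \<in> P" "b \<in> P" "c \<in> P" "a \<noteq> b" "l \<in> L" "inc a l" "inc b l" "\<not> inc c l"
    by (rule exists_line_and_point_off) blast
  define R where "R y = {x \<in> P. x \<noteq> c \<and> collinear3 L inc c y x}" for y
  define Y where "Y = {y \<in> P. inc y l}"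
  have Y: "finite Y" "card Y = q + 1"
    using finite_line card_line l by (auto simp: Y_def)
  have R: "finite (R y)" "card (R y) = q" if "y \<in> Y" for y
    using that card_punctured_line[of c y] l by (auto simp: R_def Y_def)
  have "x \<in> insert c (\<Union>y\<in>Y. R y)" if x: "x \<in> P" for x
  proof (cases "x = c")
    case False
    obtain m where m: "m \<in> L" "inc c m" "inc x m"
      by (rule line_through[of c x]) (use x l False in auto)
    then obtain y where "y \<in> P" "inc y l" "inc y m"
      using unique_point[of l m] l by blast
    then show ?thesis
      using m x False by (auto simp: R_def Y_def collinear3_def)
  qed auto
  then have sub: "P \<subseteq> insert c (\<Union>y\<in>Y. R y)"
    by blast
  have fin: "finite (insert c (\<Union>y\<in>Y. R y))"
    using Y R by auto
  show "finite P"
    using finite_subset[OF sub fin] .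
  have "card P \<le> card (insert c (\<Union>y\<in>Y. R y))"
    using card_mono[OF fin sub] .
  also have "\<dots> \<le> Suc (card (\<Union>y\<in>Y. R y))"
    by (rule card_insert_le_m1) auto
  also have "card (\<Union>y\<in>Y. R y) \<le> (\<Sum>y\<in>Y. card (R y))"
    using Y(1) by (rule card_UN_le)
  also have "\<dots> = (q + 1) * q"
    using R Y by simp
  finally show "card P \<le> q\<^sup>2 + q + 1"
    by (simp add: power2_eq_square)
qed

lemma card_covering_points_ge:
  assumes S: "S \<subseteq> P" and b: "b \<in> uncovered P L inc S"
  shows "card S * (q - 1) + 1 \<le> card {a \<in> P - S. covers L inc S a b}"
proof -
  have bP: "b \<in> P" "b \<notin> S" and
    bS: "\<And>p p'. p \<in> S \<Longrightarrow> p' \<in> S \<Longrightarrow> p \<noteq> p' \<Longrightarrow> \<not> collinear3 L inc p p' b"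
    using b by (auto simp: uncovered_def)
  have finS: "finite S"
    using S finite_points finite_subset by blast
  \<comment> \<open>The line through \<open>b\<close> and \<open>p\<close> without these two points:
    \<open>q - 1\<close> points, none of them in \<open>S\<close> because \<open>b\<close> is on no
    secant. The final + 1 in the count is \<open>b\<close> itself.\<close>
  define R where "R p = {x \<in> P. x \<noteq> b \<and> collinear3 L inc b p x} - {p}" for p
  have R: "finite (R p)" "card (R p) = q - 1" if "p \<in> S" for p
  proof -
    have pP: "p \<in> P" "b \<noteq> p"
      using that S bP by auto
    have "p \<in> {x \<in> P. x \<noteq> b \<and> collinear3 L inc b p x}"
      using line_through[OF bP(1) pP] pP by blast
    then show "finite (R p)" "card (R p) = q - 1"
      using card_punctured_line[OF bP(1) pP] by (auto simp: R_def)
  qed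
  have disj: "R p \<inter> R p' = {}" if pp: "p \<in> S" "p' \<in> S" "p \<noteq> p'" for p p'
  proof (rule ccontr)
    assume "R p \<inter> R p' \<noteq> {}"
    then obtain x where x: "x \<in> P" "x \<noteq> b" "collinear3 L inc b p x" "collinear3 L inc b p' x"
      by (auto simp: R_def)
    \<comment> \<open>Both lines equal the one through \<open>b\<close> and \<open>x\<close>, so
      \<open>p\<close> and \<open>p'\<close> would span a secant through \<open>b\<close>.\<close>
    then obtain l where "l \<in> L" "inc b l" "inc p l" "inc p' l"
      using unique_line[of b x] bP unfolding collinear3_def by blast
    then show False
      using bS[OF pp] by (auto simp: collinear3_def)
  qed
  have "card (\<Union>p\<in>S. R p) = (\<Sum>p\<in>S. card (R p))"
    using finS R disj by (intro card_UN_disjoint) auto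
  also have "\<dots> = card S * (q - 1)"
    using R by simp
  finally have "card (insert b (\<Union>p\<in>S. R p)) = card S * (q - 1) + 1"
    using finS R by (subst card_insert_disjoint) (auto simp: R_def)
  moreover have "insert b (\<Union>p\<in>S. R p) \<subseteq> {a \<in> P - S. covers L inc S a b}"
  proof -
    have "x \<in> P \<and> x \<notin> S \<and> covers L inc S x b" if "p \<in> S" "x \<in> R p" for x p
    proof -
      have "x \<in> P" "x \<noteq> p" "collinear3 L inc p x b"
        using that(2) by (auto simp: R_def collinear3_def)
      then show ?thesis
        using bS[of p x] that(1) by (auto simp: covers_def)
    qed
    then show ?thesis
      using bP by (auto simp: covers_def)
  qed
  ultimately show ?thesis
    using card_mono[of "{a \<in> P - S. covers L inc S a b}" "insert b (\<Union>p\<in>S. R p)"] finite_points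
    by auto
qed

lemma exists_point_covering_fraction:
  assumes q: "q \<ge> 1" and S: "S \<subseteq> P" and ne: "uncovered P L inc S \<noteq> {}"
  obtains a where "a \<in> P - S"
    "real (card (uncovered P L inc (insert a S)))
      \<le> real (card (uncovered P L inc S)) * (1 - (real (card S) - 1/2) / (real q + 1))"
proof -
  let ?U = "uncovered P L inc S"
  define w u where "w = real (card S)" and "u = real (card ?U)"
  define C where "C a = {b \<in> ?U. covers L inc S a b}" for a
  have fin: "finite P" "finite S" "finite ?U"
    using finite_points S uncovered_subset[of P L inc S] by (auto intro: finite_subset)
  have PS: "P - S \<noteq> {}"
    using ne uncovered_subset[of P L inc S] by auto
  \<comment> \<open>Lower bound for the average fraction covered by one point: the denominator
    bounds the number of points outside \<open>S\<close> from above.\<close>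
  define r where "r = (w * (real q - 1) + 1) / ((real q)\<^sup>2 + real q + 1 - w)"
  have cPS: "real (card (P - S)) \<le> (real q)\<^sup>2 + real q + 1 - w"
  proof -
    have "real (card P) \<le> real (q\<^sup>2 + q + 1)"
      using card_points_le of_nat_mono by blast
    then show ?thesis
      using S fin card_mono[of P S] by (simp add: card_Diff_subset w_def)
  qed
  have pos: "0 < real (card (P - S))"
    using PS fin by (simp add: card_gt_0_iff)
  have num: "0 \<le> w * (real q - 1) + 1"
    using q by (auto simp: w_def)
  \<comment> \<open>Double counting of the pairs (\<open>a\<close>, \<open>b\<close>) with
    \<open>a\<close> covering \<open>b\<close>: by points \<open>b\<close> there are at least
    \<open>w * (q - 1) + 1\<close> for each, so the sum over \<open>a\<close> cannot stay below
    average everywhere.\<close>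
  have "\<exists>a\<in>P - S. u * r \<le> real (card (C a))"
  proof (rule ccontr)
    assume "\<not> ?thesis"
    then have "(\<Sum>a\<in>P - S. real (card (C a))) < (\<Sum>a\<in>P - S. u * r)"
      using fin(1) PS by (intro sum_strict_mono) (simp_all add: not_le)
    also have "\<dots> = real (card (P - S)) * (u * r)"
      by simp
    also have "\<dots> \<le> ((real q)\<^sup>2 + real q + 1 - w) * (u * r)"
      using cPS num pos by (intro mult_right_mono) (auto simp: u_def r_def)
    also have "\<dots> = u * (w * (real q - 1) + 1)"
      using cPS pos by (simp add: r_def)
    also have "\<dots> = (\<Sum>b\<in>?U. real (card S * (q - 1) + 1))"
      using q by (simp add: u_def w_def of_nat_diff)
    also have "\<dots> \<le> (\<Sum>b\<in>?U. real (card {a \<in> P - S. covers L inc S a b}))"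
      using card_covering_points_ge[OF S] by (intro sum_mono of_nat_mono) auto
    also have "\<dots> = real (\<Sum>b\<in>?U. \<Sum>a\<in>P - S. if covers L inc S a b then 1 else 0)"
      using fin by (simp add: sum.If_cases Int_def)
    also have "\<dots> = real (\<Sum>a\<in>P - S. \<Sum>b\<in>?U. if covers L inc S a b then 1 else 0)"
      by (subst sum.swap) simp
    also have "\<dots> = (\<Sum>a\<in>P - S. real (card (C a)))"
      using fin by (simp add: sum.If_cases Int_def C_def)
    finally show False
      by simp
  qed
  then obtain a where a: "a \<in> P - S" "u * r \<le> real (card (C a))"
    by blast
  have "card (uncovered P L inc (insert a S)) \<le> card (?U - C a)"
    using uncovered_insert_subset[of P L inc a S] fin by (intro card_mono) (auto simp: C_def)
  also have "\<dots> = card ?U - card (C a)"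
    using fin by (intro card_Diff_subset) (auto simp: C_def)
  finally have "real (card (uncovered P L inc (insert a S))) \<le> u - real (card (C a))"
    using card_mono[of ?U "C a"] fin by (auto simp: u_def C_def)
  also have "\<dots> \<le> u - u * ((w - 1/2) / (real q + 1))"
  proof -
    have "(w - 1/2) / (real q + 1) \<le> r"
      unfolding r_def using q cPS pos by (intro covering_fraction_bound) auto
    then have "u * ((w - 1/2) / (real q + 1)) \<le> u * r"
      by (intro mult_left_mono) (auto simp: u_def)
    with a show ?thesis
      by linarith
  qed
  finally have "real (card (uncovered P L inc (insert a S)))
      \<le> u * (1 - (w - 1/2) / (real q + 1))"
    by (simp add: right_diff_distrib)
  with a(1) show ?thesis
    using that unfolding u_def w_def by blast
qed

text \<open>The process may run out of uncovered points before reaching size \<open>n\<close>; the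
  disjunction records this, and the bound then holds trivially. At \<open>n = 2\<close> the exponent
  is 0.\<close>

lemma exists_greedy_set:
  assumes q: "q \<ge> 1" and n: "n \<ge> 2"
  shows "\<exists>S\<subseteq>P. 2 \<le> card S \<and> card S \<le> n \<and> (card S = n \<or> uncovered P L inc S = {}) \<and>
    real (card (uncovered P L inc S))
      \<le> (real q)\<^sup>2 * exp (- (((real n - 1)\<^sup>2 - 1) / (2 * (real q + 1))))"
  using n
proof (induction n rule: dec_induct)
  case base
  obtain a b l where l: "a \<in> P" "b \<in> P" "a \<noteq> b" "l \<in> L" "\<And>x. collinear3 L inc a b x \<longleftrightarrow> inc x l"
    by (rule exists_line_and_point_off) blast
  \<comment> \<open>Only points off the line through \<open>a\<close> and \<open>b\<close> can be
    uncovered, at most \<open>q\<^sup>2 + q + 1 - (q + 1)\<close> of them.\<close>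
  have "uncovered P L inc {a, b} \<subseteq> P - {x \<in> P. inc x l}"
    using l by (auto simp: uncovered_def)
  then have "card (uncovered P L inc {a, b}) \<le> card (P - {x \<in> P. inc x l})"
    using finite_points by (intro card_mono) auto
  also have "\<dots> = card P - (q + 1)"
    using finite_points card_line[OF l(4)] by (subst card_Diff_subset) auto
  also have "\<dots> \<le> q\<^sup>2"
    using card_points_le by simp
  finally have "real (card (uncovered P L inc {a, b})) \<le> (real q)\<^sup>2"
    by (metis of_nat_mono of_nat_power)
  then show ?case
    using l by (intro exI[of _ "{a, b}"]) auto
next
  case (step n)
  let ?B = "\<lambda>n. (real q)\<^sup>2 * exp (- (((real n - 1)\<^sup>2 - 1) / (2 * (real q + 1))))"
  obtain S where S: "S \<subseteq> P" "2 \<le> card S" "card S \<le> n" "card S = n \<or> uncovered P L inc S = {}"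
    "real (card (uncovered P L inc S)) \<le> ?B n"
    using step.IH by blast
  show ?case
  proof (cases "uncovered P L inc S = {}")
    case True
    then show ?thesis
      using S by (intro exI[of _ S]) auto
  next
    case False
    with S have cS: "card S = n"
      by blast
    obtain a where a: "a \<in> P - S" "real (card (uncovered P L inc (insert a S)))
      \<le> real (card (uncovered P L inc S)) * (1 - (real (card S) - 1/2) / (real q + 1))"
      using exists_point_covering_fraction[OF q S(1) False] .
    let ?x = "(real n - 1/2) / (real q + 1)"
    note a(2)
    also have "real (card (uncovered P L inc S)) * (1 - (real (card S) - 1/2) / (real q + 1))
        \<le> real (card (uncovered P L inc S)) * exp (- ?x)"
      using exp_ge_add_one_self[of "- ?x"] cS by (intro mult_left_mono) auto
    also have "\<dots> \<le> ?B n * exp (- ?x)"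
      using S(5) by (intro mult_right_mono) auto
    also have "\<dots> = ?B (Suc n)"
    proof -
      \<comment> \<open>The fraction being linear in \<open>n\<close>, the exponents telescope:
        \<open>2 * n - 1\<close> is the difference of the squares of \<open>n\<close> and
        \<open>n - 1\<close>.\<close>
      have "?x = (2 * real n - 1) / (2 * (real q + 1))"
        by (simp add: field_simps)
      then have "((real n - 1)\<^sup>2 - 1) / (2 * (real q + 1)) + ?x
          = ((real (Suc n) - 1)\<^sup>2 - 1) / (2 * (real q + 1))"
        by (simp add: power2_eq_square algebra_simps flip: add_divide_distrib)
      then show ?thesis
        by (simp only: mult.assoc flip: exp_add minus_add_distrib)
    qed
    finally have "real (card (uncovered P L inc (insert a S))) \<le> ?B (Suc n)" .
    moreover have "card (insert a S) = Suc n"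
      using a(1) cS finite_subset[OF S(1) finite_points] by simp
    ultimately show ?thesis
      using a(1) S step.hyps by (intro exI[of _ "insert a S"]) auto
  qed
qed

text \<open>Any line through \<open>c\<close> meets \<open>l\<close> in a point other than
  \<open>c\<close>, so every remaining point lies on a secant through \<open>c\<close>.\<close>

lemma smallest_saturating_size_le_order_plus_2: "smallest_saturating_size P L inc \<le> q + 2"
proof -
  obtain a b c l where l: "a \<in> P" "b \<in> P" "c \<in> P" "l \<in> L" "\<not> inc c l"
    by (rule exists_line_and_point_off) blast
  let ?S = "insert c {x \<in> P. inc x l}"
  have "saturating P L inc ?S"
    unfolding saturating_def
  proof (intro conjI ballI)
    fix x assume x: "x \<in> P - ?S"
    obtain m where m: "m \<in> L" "inc c m" "inc x m"
      by (rule line_through[of c x]) (use l x in auto)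
    then obtain y where "y \<in> P" "inc y l" "inc y m"
      using unique_point[of l m] l by blast
    then show "\<exists>a\<in>?S. \<exists>b\<in>?S. a \<noteq> b \<and> collinear3 L inc a b x"
      using m l by (intro bexI[of _ c] bexI[of _ y]) (auto simp: collinear3_def)
  qed (use l in auto)
  then have "smallest_saturating_size P L inc \<le> card ?S"
    using finite_line[OF l(4)] by (intro smallest_saturating_size_le) auto
  also have "card ?S = q + 2"
    using finite_line[OF l(4)] card_line[OF l(4)] l by simp
  finally show ?thesis .
qed

end

section \<open>The bound: length of the greedy phase\<close>

theorem theorem2:
  fixes P :: "'p set" and L :: "'l set" and inc :: "'p \<Rightarrow> 'l \<Rightarrow> bool"
    and q :: nat and \<xi> :: real
  assumes "q \<ge> 2"
    and "projective_plane_of_order P L inc q"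
    and "1 \<le> \<xi>" and "\<xi> \<le> (real q)\<^sup>2"
  shows "real (smallest_saturating_size P L inc)
    \<le> sqrt (2 * (real q + 1)) * sqrt (ln ((real q)\<^sup>2 / \<xi>)) + \<xi> / 2 + 3"
proof -
  interpret projective_plane_of_order P L inc q
    by fact
  define t where "t = ln ((real q)\<^sup>2 / \<xi>)"
  define T where "T = sqrt (2 * (real q + 1)) * sqrt t"
  have t0: "t \<ge> 0"
    using assms by (auto simp: t_def intro!: ln_ge_zero)
  have T0: "T \<ge> 0" and T2: "T\<^sup>2 = 2 * (real q + 1) * t"
    using t0 by (auto simp: T_def power_mult_distrib)
  have "real (smallest_saturating_size P L inc) \<le> T + \<xi> / 2 + 3"
  proof (cases "\<xi> \<ge> (real q)\<^sup>2 / 2")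
    case True
    have "real (smallest_saturating_size P L inc) \<le> real q + 2"
      using smallest_saturating_size_le_order_plus_2 by linarith
    \<comment> \<open>This gives \<open>q + 2 \<le> q\<^sup>2 / 4 + 3\<close>, and here \<xi>/2 is
      at least \<open>q\<^sup>2 / 4\<close>.\<close>
    moreover have "0 \<le> (real q - 2)\<^sup>2"
      by simp
    then have "real q \<le> (real q)\<^sup>2 / 4 + 1"
      by (simp add: power2_eq_square field_simps)
    ultimately show ?thesis
      using True T0 by linarith
  next
    case False
    \<comment> \<open>Now \<open>q\<^sup>2 / \<xi>\<close> exceeds 2, so \<open>t\<close> is at
      least 1/2 and \<open>T\<^sup>2\<close> at least \<open>q + 1\<close>; only
      \<open>T \<ge> 1\<close> is kept.\<close>
    have "1/2 \<le> ln (2::real)"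
      using ln_le_minus_one[of "1/2::real"] by (simp add: ln_div)
    also have "\<dots> \<le> t"
      unfolding t_def using False assms by (subst ln_le_cancel_iff) (auto simp: field_simps)
    finally have "2 * (real q + 1) * (1/2) \<le> 2 * (real q + 1) * t"
      by (intro mult_left_mono) auto
    moreover have "1 \<le> 2 * (real q + 1) * (1/2)"
      by simp
    ultimately have "1\<^sup>2 \<le> T\<^sup>2"
      unfolding T2 one_power2 by (rule order_trans[rotated])
    then have T1: "T \<ge> 1"
      using T0 power2_le_imp_le by blast
    \<comment> \<open>The shift 3/2 serves both ends. The square of \<open>T + 1/2\<close> is
      \<open>T\<^sup>2 + T + 1/4\<close>, which is at least \<open>T\<^sup>2 + 1\<close> as
      \<open>T \<ge> 1\<close>, so at most \<xi> points stay uncovered. Above,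
      \<open>n < T + 5/2\<close> leaves the 1/2 that rounding up may cost in the pairing phase, for
      a total of 3.\<close>
    define n where "n = nat \<lceil>T + 3/2\<rceil>"
    have n: "T + 3/2 \<le> real n" "real n < T + 5/2"
      using T1 unfolding n_def by linarith+
    then have "n \<ge> 2"
      using T1 by linarith
    then obtain S where S: "S \<subseteq> P" "2 \<le> card S" "card S \<le> n"
      "real (card (uncovered P L inc S))
        \<le> (real q)\<^sup>2 * exp (- (((real n - 1)\<^sup>2 - 1) / (2 * (real q + 1))))"
      using exists_greedy_set[of n] assms by auto
    have "(T + 1/2)\<^sup>2 \<le> (real n - 1)\<^sup>2"
      using n T1 by (intro power_mono) auto
    then have "T\<^sup>2 \<le> (real n - 1)\<^sup>2 - 1"
      using T1 by (simp add: power2_eq_square field_simps)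
    then have "t \<le> ((real n - 1)\<^sup>2 - 1) / (2 * (real q + 1))"
      using T2 by (simp add: field_simps)
    then have "(real q)\<^sup>2 * exp (- (((real n - 1)\<^sup>2 - 1) / (2 * (real q + 1))))
        \<le> (real q)\<^sup>2 * exp (- t)"
      by (intro mult_left_mono) auto
    also have "\<dots> = \<xi>"
      using assms by (simp add: t_def exp_minus)
    finally have U: "real (card (uncovered P L inc S)) \<le> \<xi>"
      using S(4) by linarith
    obtain S' where "saturating P L inc S'" "finite S'"
      and S': "card S' \<le> card S + (card (uncovered P L inc S) + 1) div 2"
      using extend_to_saturating[OF finite_points S(1,2)] by blast
    then have "smallest_saturating_size P L inc \<le> card S'"
      by (intro smallest_saturating_size_le)
    with S' S(3) have
      "2 * smallest_saturating_size P L inc \<le> 2 * n + card (uncovered P L inc S) + 1"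
      by linarith
    with U n show ?thesis
      by linarith
  qed
  then show ?thesis
    by (simp add: T_def t_def)
qed

end
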